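(* Let $(\Omega,\mathcal{H},\hat{E})$ be a sublinear expectation space as in the context, and let $\{X_n,n\ge 1\}\subset\mathcal{H}$ be a sequence of i.i.d. random variables under $\hat{E}$ with $\hat{E}[X_n]=-\hat{E}[-X_n]=\mu$ for all $n\ge 1$, where $\mu\in\mathbb{R}$. Put $S_n=X_1+\cdots+X_n$ and $\tilde{S}_n=\sum_{i=1}^n(X_i-\hat{E}[X_i])$, so that $\frac{\tilde{S}_n}{n}=\frac{S_n}{n}-\mu$. Suppose that $\hat{E}[|X_1|^{\alpha}]<\infty$ for some $\alpha>2$. Then for any $\beta>2$, $\frac{\tilde{S}_n}{n}$ strongly quasi surely converges to $0$ with order $\beta$ (equivalently, $\frac{S_n}{n}$ strongly quasi surely converges to $\mu$ with order $\beta$), i.e. $$\sum_{n=1}^{\infty}\left|\frac{S_n}{n}-\mu\right|^{\beta}<\infty\quad\text{quasi surely}.$$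
   Context: Setting. $\Omega$ is a complete separable metric space with Borel $\sigma$-algebra $\mathcal{B}(\Omega)$. $\mathcal{H}$ is a linear space of real (Borel measurable) functions on $\Omega$ that contains all constants, contains $|X|$ whenever $X\in\mathcal{H}$, contains $\varphi(X_1,\dots,X_n)$ whenever $X_1,\dots,X_n\in\mathcal{H}$ and $\varphi\in C_{l,lip}(\mathbb{R}^n)$, and contains $I_A$ for every $A\in\mathcal{B}(\Omega)$. Here $C_{l,lip}(\mathbb{R}^n)$ is the linear space of functions $\varphi:\mathbb{R}^n\to\mathbb{R}$ satisfying $|\varphi(x)-\varphi(y)|\le C(1+|x|^m+|y|^m)|x-y|$ for all $x,y\in\mathbb{R}^n$, for some $C>0$, $m\in\mathbb{N}$ depending on $\varphi$. A sublinear expectation is a functional $\hat{E}:\mathcal{H}\to\mathbb{R}$ such that for all $X,Y\in\mathcal{H}$: $\hat{E}[X]\ge\hat{E}[Y]$ if $X\ge Y$; $\hat{E}[c]=c$ for $c\in\mathbb{R}$; $\hat{E}[X+Y]\le\hat{E}[X]+\hat{E}[Y]$; $\hat{E}[\lambda X]=\lambda\hat{E}[X]$ for $\lambda\ge0$. It is assumed that there is a family $\mathcal{P}$ of probability measures on $(\Omega,\mathcal{B}(\Omega))$ with $\hat{E}[X]=\sup_{P\in\mathcal{P}}E_P[X]$ for all $X\in\mathcal{H}$ (this formula is also used to give meaning to $\hat{E}$, with values in $[0,\infty]$, on nonnegative Borel functions). The capacity is $V(A)=\hat{E}[I_A]$, $A\in\mathcal{B}(\Omega)$. A property holds quasi surely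 (q.s.) if it holds outside a set $N\in\mathcal{B}(\Omega)$ with $V(N)=0$. Identical distribution: $X,Y\in\mathcal{H}$ satisfy $X\stackrel{d}{=}Y$ if $\hat{E}[\varphi(X)]=\hat{E}[\varphi(Y)]$ for all $\varphi\in C_{l,lip}(\mathbb{R})$. Independence: for $X\in\mathcal{H}^m$, $Y\in\mathcal{H}^n$, $Y$ is independent to $X$ if for every $\varphi\in C_{l,lip}(\mathbb{R}^{m+n})$, $\hat{E}[\varphi(X,Y)]=\hat{E}\big[\hat{E}[\varphi(x,Y)]_{x=X}\big]$ whenever $\bar\varphi(x):=\hat{E}[|\varphi(x,Y)|]<\infty$ for all $x$ and $\hat{E}[|\bar\varphi(X)|]<\infty$. A sequence $\{X_n,n\ge1\}\subset\mathcal{H}$ is i.i.d. if for each $i\ge1$, $X_i\stackrel{d}{=}X_1$ and $X_{i+1}$ is independent to $(X_1,\dots,X_i)$. For $\alpha>0$, $Y_n$ is said to strongly quasi surely converge to $Y$ with order $\alpha$ if $\sum_{n=1}^\infty|Y_n-Y|^\alpha<\infty$ q.s. *)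

theory Defs
  imports "HOL-Probability.Probability"
begin

text \<open>
  Vectors of arbitrary dimension \<open>n\<close> are represented by functions of type
  \<open>nat \<Rightarrow> real\<close>, of which only the coordinates with index \<open>< n\<close> are relevant.
  The Euclidean norm is \<open>L2_set x {..<n}\<close>. The growth condition below forces
  \<open>\<phi> x = \<phi> y\<close> whenever \<open>x\<close> and \<open>y\<close> agree on the coordinates \<open>< n\<close>, so the members
  of \<open>C_llip n\<close> are exactly the locally Lipschitz functions on the \<open>n\<close>-dimensional
  space, precomposed with the projection to the first \<open>n\<close> coordinates.
\<close>

definition C_llip :: "nat \<Rightarrow> ((nat \<Rightarrow> real) \<Rightarrow> real) set" where
  "C_llip n = {\<phi>. \<exists>C>0. \<exists>m::nat. \<forall>x y.
     \<bar>\<phi> x - \<phi> y\<bar> \<le> C * (1 + L2_set x {..<n} ^ m + L2_set y {..<n} ^ m)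
                       * L2_set (\<lambda>i. x i - y i) {..<n}}"

definition C_llip_real :: "(real \<Rightarrow> real) set" where
  "C_llip_real = {\<phi>. \<exists>C>0. \<exists>m::nat. \<forall>x y.
     \<bar>\<phi> x - \<phi> y\<bar> \<le> C * (1 + \<bar>x\<bar> ^ m + \<bar>y\<bar> ^ m) * \<bar>x - y\<bar>}"

locale random_variable_space =
  fixes H :: "('a::polish_space \<Rightarrow> real) set"
  assumes borel: "X \<in> H \<Longrightarrow> X \<in> borel_measurable borel"
    and add: "X \<in> H \<Longrightarrow> Y \<in> H \<Longrightarrow> (\<lambda>\<omega>. X \<omega> + Y \<omega>) \<in> H"
    and scale: "X \<in> H \<Longrightarrow> (\<lambda>\<omega>. c * X \<omega>) \<in> H"
    and const: "(\<lambda>\<omega>. c) \<in> H"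
    and abs: "X \<in> H \<Longrightarrow> (\<lambda>\<omega>. \<bar>X \<omega>\<bar>) \<in> H"
    and comp: "\<phi> \<in> C_llip n \<Longrightarrow> (\<And>i. i < n \<Longrightarrow> Z i \<in> H) \<Longrightarrow> (\<lambda>\<omega>. \<phi> (\<lambda>i. Z i \<omega>)) \<in> H"
    and indicat: "A \<in> sets borel \<Longrightarrow> indicat_real A \<in> H"

text \<open>
  A functional on \<open>H\<close> is a total function whose values outside \<open>H\<close> are irrelevant.
  That \<open>E X\<close> is the real number \<open>sup\<^sub>P E\<^sub>P[X]\<close> is spelled out as: every \<open>X \<in> H\<close> is
  integrable under each \<open>P\<close>, and the (nonempty) set of integrals is bounded above with
  supremum \<open>E X\<close>; otherwise the library's default values for non-integrable functions
  and unbounded suprema would interfere.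
\<close>

locale sublinear_expectation_space = random_variable_space H
  for H :: "('a::polish_space \<Rightarrow> real) set" +
  fixes E :: "('a \<Rightarrow> real) \<Rightarrow> real" and \<P> :: "'a measure set"
  assumes mono: "X \<in> H \<Longrightarrow> Y \<in> H \<Longrightarrow> (\<And>\<omega>. X \<omega> \<ge> Y \<omega>) \<Longrightarrow> E X \<ge> E Y"
    and const_preserving: "E (\<lambda>\<omega>. c) = c"
    and subadditive: "X \<in> H \<Longrightarrow> Y \<in> H \<Longrightarrow> E (\<lambda>\<omega>. X \<omega> + Y \<omega>) \<le> E X + E Y"
    and pos_homogeneous: "X \<in> H \<Longrightarrow> c \<ge> 0 \<Longrightarrow> E (\<lambda>\<omega>. c * X \<omega>) = c * E X"
    and nonempty: "\<P> \<noteq> {}"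
    and prob: "P \<in> \<P> \<Longrightarrow> prob_space P"
    and sets_eq: "P \<in> \<P> \<Longrightarrow> sets P = sets borel"
    and integrable: "P \<in> \<P> \<Longrightarrow> X \<in> H \<Longrightarrow> integrable P X"
    and bdd: "X \<in> H \<Longrightarrow> bdd_above ((\<lambda>P. integral\<^sup>L P X) ` \<P>)"
    and representation: "X \<in> H \<Longrightarrow> E X = (SUP P\<in>\<P>. integral\<^sup>L P X)"

text \<open>The extension of the sublinear expectation to nonnegative Borel functions.\<close>

definition upper_expectation :: "'a measure set \<Rightarrow> ('a \<Rightarrow> ennreal) \<Rightarrow> ennreal" where
  "upper_expectation \<P> f = (SUP P\<in>\<P>. \<integral>\<^sup>+\<omega>. f \<omega> \<partial>P)"

definition capacity :: "(('a \<Rightarrow> real) \<Rightarrow> real) \<Rightarrow> 'a set \<Rightarrow> real" where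
  "capacity E A = E (indicat_real A)"

definition quasi_surely ::
  "(('a::topological_space \<Rightarrow> real) \<Rightarrow> real) \<Rightarrow> ('a \<Rightarrow> bool) \<Rightarrow> bool" where
  "quasi_surely E Q \<longleftrightarrow> (\<exists>N\<in>sets borel. capacity E N = 0 \<and> (\<forall>\<omega>. \<omega> \<notin> N \<longrightarrow> Q \<omega>))"

definition ident_distr ::
  "(('a \<Rightarrow> real) \<Rightarrow> real) \<Rightarrow> ('a \<Rightarrow> real) \<Rightarrow> ('a \<Rightarrow> real) \<Rightarrow> bool" where
  "ident_distr E X Y \<longleftrightarrow>
     (\<forall>\<phi>\<in>C_llip_real. E (\<lambda>\<omega>. \<phi> (X \<omega>)) = E (\<lambda>\<omega>. \<phi> (Y \<omega>)))"

definition vec_append :: "nat \<Rightarrow> (nat \<Rightarrow> real) \<Rightarrow> (nat \<Rightarrow> real) \<Rightarrow> nat \<Rightarrow> real" where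
  "vec_append m x y = (\<lambda>i. if i < m then x i else y (i - m))"

text \<open>
  \<open>indep_to E \<P> n Y m X\<close>: the \<open>n\<close>-dimensional random vector \<open>Y\<close> is independent to the
  \<open>m\<close>-dimensional random vector \<open>X\<close> (not a symmetric relation).
\<close>

definition indep_to :: "(('a \<Rightarrow> real) \<Rightarrow> real) \<Rightarrow> 'a measure set \<Rightarrow>
    nat \<Rightarrow> ('a \<Rightarrow> nat \<Rightarrow> real) \<Rightarrow> nat \<Rightarrow> ('a \<Rightarrow> nat \<Rightarrow> real) \<Rightarrow> bool" where
  "indep_to E \<P> n Y m X \<longleftrightarrow>
    (\<forall>\<phi>\<in>C_llip (m + n).
       let \<phi>bar = (\<lambda>x. upper_expectation \<P> (\<lambda>\<omega>. ennreal \<bar>\<phi> (vec_append m x (Y \<omega>))\<bar>))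
       in (\<forall>x. \<phi>bar x < \<infinity>) \<longrightarrow> upper_expectation \<P> (\<lambda>\<omega>. \<phi>bar (X \<omega>)) < \<infinity> \<longrightarrow>
          E (\<lambda>\<omega>. \<phi> (vec_append m (X \<omega>) (Y \<omega>))) =
          E (\<lambda>\<omega>'. E (\<lambda>\<omega>. \<phi> (vec_append m (X \<omega>') (Y \<omega>)))))"

text \<open>Sequences are indexed from \<open>1\<close>; the value at index \<open>0\<close> is ignored.\<close>

definition iid_seq :: "('a \<Rightarrow> real) set \<Rightarrow> (('a \<Rightarrow> real) \<Rightarrow> real) \<Rightarrow> 'a measure set \<Rightarrow>
    (nat \<Rightarrow> 'a \<Rightarrow> real) \<Rightarrow> bool" where
  "iid_seq H E \<P> X \<longleftrightarrow>
    (\<forall>i\<ge>1. X i \<in> H) \<and>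
    (\<forall>i\<ge>1. ident_distr E (X i) (X 1) \<and>
            indep_to E \<P> 1 (\<lambda>\<omega> _. X (i + 1) \<omega>) i (\<lambda>\<omega> j. X (j + 1) \<omega>))"

definition strongly_qs_converges :: "(('a::topological_space \<Rightarrow> real) \<Rightarrow> real) \<Rightarrow>
    (nat \<Rightarrow> 'a \<Rightarrow> real) \<Rightarrow> ('a \<Rightarrow> real) \<Rightarrow> real \<Rightarrow> bool" where
  "strongly_qs_converges E Y Z \<alpha> \<longleftrightarrow>
     quasi_surely E (\<lambda>\<omega>. summable (\<lambda>n. \<bar>Y (Suc n) \<omega> - Z \<omega>\<bar> powr \<alpha>))"

end

theory Submission
  imports Defs
begin

text \<open>
  Since \<open>H\<close> is closed under locally Lipschitz functions of polynomial growth, every \<open>X\<^sub>n\<close> has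
  moments of all orders. Let \<open>T\<^sub>n\<close> be the centred sums. Expanding \<open>T\<^sub>n\<^sub>+\<^sub>1\<^sup>2\<^sup>k\<close> around \<open>T\<^sub>n\<close> to second
  order, the linear term has expectation exactly \<open>0\<close> because the mean is certain, and
  independence gives \<open>E[T\<^sub>n\<^sub>+\<^sub>1\<^sup>2\<^sup>k] \<le> E[T\<^sub>n\<^sup>2\<^sup>k] + C (E[T\<^sub>n\<^sup>2\<^sup>k\<^sup>-\<^sup>2] + 1)\<close>; by induction on \<open>k\<close>,
  \<open>E[T\<^sub>n\<^sup>2\<^sup>k] = O(n\<^sup>k)\<close>. For \<open>2k \<ge> \<beta>\<close> the bound \<open>\<bar>y\<bar>\<^sup>\<beta> \<le> 1 + y\<^sup>2\<^sup>k\<close> with \<open>y = T\<^sub>n / \<surd>n\<close> shows that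
  the \<open>\<beta>\<close>-th moment of \<open>T\<^sub>n / n\<close> is \<open>O(n\<^sup>-\<^sup>\<beta>\<^sup>/\<^sup>2)\<close> uniformly over \<open>\<P>\<close>, which is summable.
\<close>

section \<open>Locally Lipschitz functions of polynomial growth\<close>

lemma one_add_powers_le:
  fixes a b :: real
  assumes "a \<ge> 0" "b \<ge> 0"
  shows "1 + a ^ m + b ^ m \<le> 3 * (1 + a + b) ^ m"
proof -
  have "1 \<le> (1 + a + b) ^ m" "a ^ m \<le> (1 + a + b) ^ m" "b ^ m \<le> (1 + a + b) ^ m"
    using assms by (auto intro!: one_le_power power_mono)
  then show ?thesis by linarith
qed

lemma power_one_add_le:
  fixes a b :: real
  assumes "a \<ge> 0" "b \<ge> 0"
  shows "(1 + a + b) ^ m \<le> 3 ^ m * (1 + a ^ m + b ^ m)"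
proof -
  define M where "M = max 1 (max a b)"
  have "(1 + a + b) ^ m \<le> (3 * M) ^ m"
    using assms by (intro power_mono) (auto simp: M_def)
  also have "M ^ m \<le> 1 + a ^ m + b ^ m"
    using assms by (auto simp: M_def max_def)
  then have "(3 * M) ^ m \<le> 3 ^ m * (1 + a ^ m + b ^ m)"
    by (simp add: power_mult_distrib)
  finally show ?thesis .
qed

text \<open>A single power of one plus the two norms is easier to handle than a sum of powers: its
  base is at least 1, so exponents can be raised to a common value, and in products they simply add.
  Allowing \<open>C = 0\<close> covers constant functions directly.\<close>

lemma C_llip_iff:
  "\<phi> \<in> C_llip n \<longleftrightarrow> (\<exists>C\<ge>0. \<exists>m. \<forall>x y.
     \<bar>\<phi> x - \<phi> y\<bar> \<le> C * (1 + L2_set x {..<n} + L2_set y {..<n}) ^ m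
                       * L2_set (\<lambda>i. x i - y i) {..<n})"
proof
  assume "\<phi> \<in> C_llip n"
  then obtain C m where C: "C > 0" and *: "\<And>x y. \<bar>\<phi> x - \<phi> y\<bar>
      \<le> C * (1 + L2_set x {..<n} ^ m + L2_set y {..<n} ^ m) * L2_set (\<lambda>i. x i - y i) {..<n}"
    unfolding C_llip_def by blast
  have "\<bar>\<phi> x - \<phi> y\<bar> \<le> (3 * C) * (1 + L2_set x {..<n} + L2_set y {..<n}) ^ m
                       * L2_set (\<lambda>i. x i - y i) {..<n}" for x y
  proof -
    have "C * (1 + L2_set x {..<n} ^ m + L2_set y {..<n} ^ m)
        \<le> C * (3 * (1 + L2_set x {..<n} + L2_set y {..<n}) ^ m)"
      using C by (intro mult_left_mono one_add_powers_le) auto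
    then have "C * (1 + L2_set x {..<n} ^ m + L2_set y {..<n} ^ m) * L2_set (\<lambda>i. x i - y i) {..<n}
        \<le> (3 * C) * (1 + L2_set x {..<n} + L2_set y {..<n}) ^ m * L2_set (\<lambda>i. x i - y i) {..<n}"
      by (intro mult_right_mono) (auto simp: mult_ac)
    with *[of x y] show ?thesis by linarith
  qed
  then show "\<exists>C\<ge>0. \<exists>m. \<forall>x y.
     \<bar>\<phi> x - \<phi> y\<bar> \<le> C * (1 + L2_set x {..<n} + L2_set y {..<n}) ^ m
                       * L2_set (\<lambda>i. x i - y i) {..<n}"
    using C by (intro exI[of _ "3 * C"]) auto
next
  assume "\<exists>C\<ge>0. \<exists>m. \<forall>x y.
     \<bar>\<phi> x - \<phi> y\<bar> \<le> C * (1 + L2_set x {..<n} + L2_set y {..<n}) ^ m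
                       * L2_set (\<lambda>i. x i - y i) {..<n}"
  then obtain C m where C: "C \<ge> 0" and *: "\<And>x y. \<bar>\<phi> x - \<phi> y\<bar>
      \<le> C * (1 + L2_set x {..<n} + L2_set y {..<n}) ^ m * L2_set (\<lambda>i. x i - y i) {..<n}"
    by blast
  \<comment> \<open>\<open>C + 1\<close> replaces \<open>C\<close> because \<open>C_llip_def\<close>
    asks for a strictly positive constant.\<close>
  have "\<bar>\<phi> x - \<phi> y\<bar> \<le> ((C + 1) * 3 ^ m) * (1 + L2_set x {..<n} ^ m + L2_set y {..<n} ^ m)
                       * L2_set (\<lambda>i. x i - y i) {..<n}" for x y
  proof -
    have "C * (1 + L2_set x {..<n} + L2_set y {..<n}) ^ m
        \<le> (C + 1) * (3 ^ m * (1 + L2_set x {..<n} ^ m + L2_set y {..<n} ^ m))"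
      using C by (intro mult_mono power_one_add_le) auto
    then have "C * (1 + L2_set x {..<n} + L2_set y {..<n}) ^ m * L2_set (\<lambda>i. x i - y i) {..<n}
        \<le> ((C + 1) * 3 ^ m) * (1 + L2_set x {..<n} ^ m + L2_set y {..<n} ^ m)
            * L2_set (\<lambda>i. x i - y i) {..<n}"
      by (intro mult_right_mono) (auto simp: mult_ac)
    with *[of x y] show ?thesis by linarith
  qed
  then show "\<phi> \<in> C_llip n"
    unfolding C_llip_def using C
    by (intro CollectI exI[of _ "(C + 1) * 3 ^ m"] conjI exI[of _ m]) auto
qed

lemma C_llipI:
  assumes "C \<ge> 0"
    and "\<And>x y. \<bar>\<phi> x - \<phi> y\<bar> \<le> C * (1 + L2_set x {..<n} + L2_set y {..<n}) ^ m
                       * L2_set (\<lambda>i. x i - y i) {..<n}"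
  shows "\<phi> \<in> C_llip n"
  using assms unfolding C_llip_iff by blast

lemma C_llipE:
  assumes "\<phi> \<in> C_llip n"
  obtains C m where "C \<ge> 0"
    and "\<And>x y. \<bar>\<phi> x - \<phi> y\<bar> \<le> C * (1 + L2_set x {..<n} + L2_set y {..<n}) ^ m
                       * L2_set (\<lambda>i. x i - y i) {..<n}"
  using assms unfolding C_llip_iff by blast

lemma C_llip_const [simp]: "(\<lambda>_. c) \<in> C_llip n"
  by (rule C_llipI[of 0]) auto

lemma C_llip_coord:
  assumes "i < n"
  shows "(\<lambda>x. x i) \<in> C_llip n"
proof (rule C_llipI[where C = 1 and m = 0])
  fix x y :: "nat \<Rightarrow> real"
  have "\<bar>x i - y i\<bar> \<le> L2_set (\<lambda>i. \<bar>x i - y i\<bar>) {..<n}"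
    using assms by (intro member_le_L2_set) auto
  also have "\<dots> = L2_set (\<lambda>i. x i - y i) {..<n}"
    by (simp add: L2_set_def)
  finally show "\<bar>x i - y i\<bar> \<le> 1 * (1 + L2_set x {..<n} + L2_set y {..<n}) ^ 0
      * L2_set (\<lambda>i. x i - y i) {..<n}" by simp
qed simp

lemma C_llip_add:
  assumes "f \<in> C_llip n" "g \<in> C_llip n"
  shows "(\<lambda>x. f x + g x) \<in> C_llip n"
proof -
  obtain C p where C: "C \<ge> 0" and f: "\<And>x y. \<bar>f x - f y\<bar>
      \<le> C * (1 + L2_set x {..<n} + L2_set y {..<n}) ^ p * L2_set (\<lambda>i. x i - y i) {..<n}"
    using assms(1) by (rule C_llipE) blast
  obtain D q where D: "D \<ge> 0" and g: "\<And>x y. \<bar>g x - g y\<bar>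
      \<le> D * (1 + L2_set x {..<n} + L2_set y {..<n}) ^ q * L2_set (\<lambda>i. x i - y i) {..<n}"
    using assms(2) by (rule C_llipE) blast
  show ?thesis
  \<comment> \<open>\<open>p + q\<close> is a common upper bound for both exponents, which suffices
    since the base is at least 1.\<close>
  proof (rule C_llipI[where C = "C + D" and m = "p + q"])
    fix x y
    let ?R = "1 + L2_set x {..<n} + L2_set y {..<n}" and ?d = "L2_set (\<lambda>i. x i - y i) {..<n}"
    have "C * ?R ^ p * ?d \<le> C * ?R ^ (p + q) * ?d" "D * ?R ^ q * ?d \<le> D * ?R ^ (p + q) * ?d"
      using C D by (auto intro!: mult_right_mono mult_left_mono power_increasing)
    with f[of x y] g[of x y] show "\<bar>f x + g x - (f y + g y)\<bar> \<le> (C + D) * ?R ^ (p + q) * ?d"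
      unfolding distrib_right by linarith
  qed (use C D in simp)
qed

text \<open>Comparison with the origin: the distance to 0 is the norm itself, which is absorbed by
  one more power of \<open>1 + L2_set x {..<n}\<close>.\<close>

lemma C_llip_growth:
  assumes "f \<in> C_llip n"
  obtains A p where "A \<ge> 0" "\<And>x. \<bar>f x\<bar> \<le> A * (1 + L2_set x {..<n}) ^ p"
proof -
  obtain C p where C: "C \<ge> 0" and f: "\<And>x y. \<bar>f x - f y\<bar>
      \<le> C * (1 + L2_set x {..<n} + L2_set y {..<n}) ^ p * L2_set (\<lambda>i. x i - y i) {..<n}"
    using assms by (rule C_llipE) blast
  have "\<bar>f x\<bar> \<le> (\<bar>f (\<lambda>_. 0)\<bar> + C) * (1 + L2_set x {..<n}) ^ Suc p" for x
  proof -
    let ?r = "L2_set x {..<n}"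
    have "\<bar>f x - f (\<lambda>_. 0)\<bar> \<le> C * (1 + ?r) ^ p * ?r"
      using f[of x "\<lambda>_. 0"] by (simp add: L2_set_constant)
    also have "\<dots> \<le> C * (1 + ?r) ^ p * (1 + ?r)"
      using C by (intro mult_left_mono) auto
    finally have 1: "\<bar>f x - f (\<lambda>_. 0)\<bar> \<le> C * (1 + ?r) ^ Suc p"
      by (simp add: mult_ac)
    have "\<bar>f (\<lambda>_. 0)\<bar> * 1 \<le> \<bar>f (\<lambda>_. 0)\<bar> * (1 + ?r) ^ Suc p"
      by (intro mult_left_mono one_le_power) auto
    with 1 show ?thesis unfolding distrib_right by linarith
  qed
  with C show thesis by (intro that[of "\<bar>f (\<lambda>_. 0)\<bar> + C" "Suc p"]) auto
qed

text \<open>As in the product rule, the difference is split as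
  \<open>f x * (g x - g y) + g y * (f x - f y)\<close>; the growth bound controls the first factor
  and the Lipschitz bound the second. The exponent \<open>r + q + s + p\<close> dominates both
  \<open>r + q\<close> and \<open>s + p\<close>.\<close>

lemma C_llip_mult:
  assumes "f \<in> C_llip n" "g \<in> C_llip n"
  shows "(\<lambda>x. f x * g x) \<in> C_llip n"
proof -
  obtain C p where C: "C \<ge> 0" and f: "\<And>x y. \<bar>f x - f y\<bar>
      \<le> C * (1 + L2_set x {..<n} + L2_set y {..<n}) ^ p * L2_set (\<lambda>i. x i - y i) {..<n}"
    using assms(1) by (rule C_llipE) blast
  obtain D q where D: "D \<ge> 0" and g: "\<And>x y. \<bar>g x - g y\<bar>
      \<le> D * (1 + L2_set x {..<n} + L2_set y {..<n}) ^ q * L2_set (\<lambda>i. x i - y i) {..<n}"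
    using assms(2) by (rule C_llipE) blast
  obtain A r where A: "A \<ge> 0" and fA: "\<And>x. \<bar>f x\<bar> \<le> A * (1 + L2_set x {..<n}) ^ r"
    using assms(1) by (rule C_llip_growth) blast
  obtain B s where B: "B \<ge> 0" and gB: "\<And>x. \<bar>g x\<bar> \<le> B * (1 + L2_set x {..<n}) ^ s"
    using assms(2) by (rule C_llip_growth) blast
  show ?thesis
  proof (rule C_llipI[where C = "A * D + B * C" and m = "r + q + s + p"])
    fix x y
    let ?R = "1 + L2_set x {..<n} + L2_set y {..<n}" and ?d = "L2_set (\<lambda>i. x i - y i) {..<n}"
    have fx: "\<bar>f x\<bar> \<le> A * ?R ^ r"
      by (rule order_trans[OF fA]) (use A in \<open>auto intro!: mult_left_mono power_mono\<close>)
    have gy: "\<bar>g y\<bar> \<le> B * ?R ^ s"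
      by (rule order_trans[OF gB]) (use B in \<open>auto intro!: mult_left_mono power_mono\<close>)
    have 1: "\<bar>f x * (g x - g y)\<bar> \<le> A * ?R ^ r * (D * ?R ^ q * ?d)"
      unfolding abs_mult using A D by (intro mult_mono fx g) auto
    have 2: "\<bar>g y * (f x - f y)\<bar> \<le> B * ?R ^ s * (C * ?R ^ p * ?d)"
      unfolding abs_mult using B C by (intro mult_mono gy f) auto
    have "A * ?R ^ r * (D * ?R ^ q * ?d) = A * D * ?R ^ (r + q) * ?d"
      by (simp add: power_add)
    also have "\<dots> \<le> A * D * ?R ^ (r + q + s + p) * ?d"
      using A D by (intro mult_right_mono mult_left_mono power_increasing) auto
    finally have 3: "A * ?R ^ r * (D * ?R ^ q * ?d) \<le> A * D * ?R ^ (r + q + s + p) * ?d" .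
    have "B * ?R ^ s * (C * ?R ^ p * ?d) = B * C * ?R ^ (s + p) * ?d"
      by (simp add: power_add)
    also have "\<dots> \<le> B * C * ?R ^ (r + q + s + p) * ?d"
      using B C by (intro mult_right_mono mult_left_mono power_increasing) auto
    finally have 4: "B * ?R ^ s * (C * ?R ^ p * ?d) \<le> B * C * ?R ^ (r + q + s + p) * ?d" .
    have "f x * g x - f y * g y = f x * (g x - g y) + g y * (f x - f y)"
      by (simp add: algebra_simps)
    with 1 2 3 4 show "\<bar>f x * g x - f y * g y\<bar> \<le> (A * D + B * C) * ?R ^ (r + q + s + p) * ?d"
      unfolding distrib_right by linarith
  qed (use A B C D in simp)
qed

lemma C_llip_power: "f \<in> C_llip n \<Longrightarrow> (\<lambda>x. f x ^ k) \<in> C_llip n"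
  by (induction k) (auto intro: C_llip_mult)

lemma C_llip_sum: "(\<And>i. i \<in> I \<Longrightarrow> f i \<in> C_llip n) \<Longrightarrow> (\<lambda>x. \<Sum>i\<in>I. f i x) \<in> C_llip n"
  by (induction I rule: infinite_finite_induct) (auto intro: C_llip_add)

text \<open>Extra coordinates only enlarge the norms in the bound. This lets a test function of the
  past be read as one of the past together with the next variable.\<close>

lemma C_llip_mono_dim:
  assumes "f \<in> C_llip m" "m \<le> n"
  shows "f \<in> C_llip n"
proof -
  have L: "L2_set z {..<m} \<le> L2_set z {..<n}" for z :: "nat \<Rightarrow> real"
    using assms(2) unfolding L2_set_def by (intro real_sqrt_le_mono sum_mono2) auto
  obtain C p where C: "C \<ge> 0" and f: "\<And>x y. \<bar>f x - f y\<bar>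
      \<le> C * (1 + L2_set x {..<m} + L2_set y {..<m}) ^ p * L2_set (\<lambda>i. x i - y i) {..<m}"
    using assms(1) by (rule C_llipE) blast
  show ?thesis
  proof (rule C_llipI[OF C])
    fix x y
    show "\<bar>f x - f y\<bar> \<le> C * (1 + L2_set x {..<n} + L2_set y {..<n}) ^ p
        * L2_set (\<lambda>i. x i - y i) {..<n}"
      using C
      by (intro order_trans[OF f] mult_mono mult_left_mono power_mono add_mono L order_refl) auto
  qed
qed

text \<open>At distance 0 the growth condition forces equality. It serves to discard the coordinate
  appended by \<open>vec_append\<close>.\<close>

lemma C_llip_cong:
  assumes "f \<in> C_llip n" "\<And>i. i < n \<Longrightarrow> x i = y i"
  shows "f x = f y"
proof -
  obtain C p where "\<bar>f x - f y\<bar>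
      \<le> C * (1 + L2_set x {..<n} + L2_set y {..<n}) ^ p * L2_set (\<lambda>i. x i - y i) {..<n}"
    using assms(1) by (rule C_llipE) blast
  moreover have "L2_set (\<lambda>i. x i - y i) {..<n} = 0"
    using assms(2) by (simp add: L2_set_eq_0_iff)
  ultimately show ?thesis by simp
qed

lemma C_llip_real_iff: "g \<in> C_llip_real \<longleftrightarrow> (\<lambda>x. g (x 0)) \<in> C_llip 1"
proof -
  have L: "L2_set z {..<1} = \<bar>z 0\<bar>" for z :: "nat \<Rightarrow> real"
    by (simp add: L2_set_def)
  \<comment> \<open>Constant sequences realise every pair of reals as coordinates 0, so quantifying
    over sequences is no weaker than quantifying over reals.\<close>
  have "\<forall>x y :: nat \<Rightarrow> real. P (x 0) (y 0) \<Longrightarrow> P a b" for P :: "real \<Rightarrow> real \<Rightarrow> bool" and a b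
    by (drule spec[of _ "\<lambda>_. a"], drule spec[of _ "\<lambda>_. b"])
  from this[of "\<lambda>x y. \<bar>g x - g y\<bar> \<le> C * (1 + \<bar>x\<bar> ^ m + \<bar>y\<bar> ^ m) * \<bar>x - y\<bar>" for C m]
  show ?thesis
    unfolding C_llip_real_def C_llip_def L mem_Collect_eq by meson
qed

lemma C_llip_real_comp_coord:
  assumes "g \<in> C_llip_real" "i < n"
  shows "(\<lambda>x. g (x i)) \<in> C_llip n"
proof -
  have L: "\<bar>z i\<bar> \<le> L2_set z {..<n}" for z :: "nat \<Rightarrow> real"
  proof -
    have "\<bar>z i\<bar> \<le> L2_set (\<lambda>i. \<bar>z i\<bar>) {..<n}"
      using assms(2) by (intro member_le_L2_set) auto
    also have "\<dots> = L2_set z {..<n}" by (simp add: L2_set_def)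
    finally show ?thesis .
  qed
  obtain C m where C: "C > 0"
    and g: "\<And>x y. \<bar>g x - g y\<bar> \<le> C * (1 + \<bar>x\<bar> ^ m + \<bar>y\<bar> ^ m) * \<bar>x - y\<bar>"
    using assms(1) unfolding C_llip_real_def by blast
  have "\<bar>g (x i) - g (y i)\<bar> \<le> C * (1 + L2_set x {..<n} ^ m + L2_set y {..<n} ^ m)
      * L2_set (\<lambda>i. x i - y i) {..<n}" for x y
    using C L[of x] L[of y] L[of "\<lambda>i. x i - y i"]
    by (intro order_trans[OF g] mult_mono mult_left_mono power_mono add_mono order_refl) auto
  with C show ?thesis unfolding C_llip_def by blast
qed

lemma C_llip_real_shifted_power: "(\<lambda>x. (x - a) ^ k) \<in> C_llip_real"
proof -
  have "(\<lambda>x. (x 0 + - a) ^ k) \<in> C_llip 1"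
    by (intro C_llip_power C_llip_add C_llip_coord C_llip_const) simp
  then show ?thesis by (simp add: C_llip_real_iff)
qed

section \<open>A second-order expansion of powers\<close>

text \<open>Induction on the exponent: multiplying the expansion by \<open>s + y\<close> multiplies
  the old remainder by \<open>s + y\<close> and creates one new term quadratic in
  \<open>y\<close>.\<close>

lemma power_add_second_order:
  "\<exists>C\<ge>0. \<forall>s y :: real. \<bar>(s + y) ^ (m + 2) - s ^ (m + 2) - real (m + 2) * s ^ (m + 1) * y\<bar>
      \<le> C * y\<^sup>2 * (\<bar>s\<bar> + \<bar>y\<bar>) ^ m"
proof (induction m)
  case 0
  show ?case by (rule exI[of _ 1]) (auto simp: power2_eq_square algebra_simps)
next
  case (Suc m)
  define R where
    "R s y = (s + y) ^ (m + 2) - s ^ (m + 2) - real (m + 2) * s ^ (m + 1) * y" for s y :: real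
  from Suc obtain C where C: "C \<ge> 0" and R: "\<And>s y. \<bar>R s y\<bar> \<le> C * y\<^sup>2 * (\<bar>s\<bar> + \<bar>y\<bar>) ^ m"
    unfolding R_def by blast
  have "\<bar>(s + y) ^ (Suc m + 2) - s ^ (Suc m + 2) - real (Suc m + 2) * s ^ (Suc m + 1) * y\<bar>
      \<le> (C + real (m + 2)) * y\<^sup>2 * (\<bar>s\<bar> + \<bar>y\<bar>) ^ Suc m" for s y
  proof -
    \<comment> \<open>The extra term is the linear term of the old expansion times
      \<open>y\<close>.\<close>
    have eq: "(s + y) ^ (Suc m + 2) - s ^ (Suc m + 2) - real (Suc m + 2) * s ^ (Suc m + 1) * y
        = (s + y) * R s y + real (m + 2) * y\<^sup>2 * s ^ Suc m"
      unfolding R_def by (simp add: algebra_simps power2_eq_square)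
    have 1: "\<bar>(s + y) * R s y\<bar> \<le> (\<bar>s\<bar> + \<bar>y\<bar>) * (C * y\<^sup>2 * (\<bar>s\<bar> + \<bar>y\<bar>) ^ m)"
      unfolding abs_mult using C by (intro mult_mono R) (auto intro: abs_triangle_ineq)
    have 2: "\<bar>real (m + 2) * y\<^sup>2 * s ^ Suc m\<bar> \<le> real (m + 2) * y\<^sup>2 * (\<bar>s\<bar> + \<bar>y\<bar>) ^ Suc m"
      by (simp add: abs_mult power_abs mult_left_mono power_mono del: power_Suc)
    have "(\<bar>s\<bar> + \<bar>y\<bar>) * (C * y\<^sup>2 * (\<bar>s\<bar> + \<bar>y\<bar>) ^ m) + real (m + 2) * y\<^sup>2 * (\<bar>s\<bar> + \<bar>y\<bar>) ^ Suc m
       = (C + real (m + 2)) * y\<^sup>2 * (\<bar>s\<bar> + \<bar>y\<bar>) ^ Suc m"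
      by (simp add: algebra_simps)
    with 1 2 show ?thesis unfolding eq by linarith
  qed
  with C show ?case by (intro exI[of _ "C + real (m + 2)"]) auto
qed

text \<open>The remainder is brought into a form in which \<open>s\<close> and \<open>y\<close>
  occur only in products of even powers. Such products are nonnegative, so their expectations will
  factor under independence.\<close>

lemma even_power_add_le:
  obtains C where "C \<ge> 0" "\<And>s y :: real. (s + y) ^ (2 * Suc k)
      \<le> s ^ (2 * Suc k) + real (2 * Suc k) * (s ^ (2 * k + 1) * y)
         + C * (s ^ (2 * k) * y\<^sup>2) + C * y ^ (2 * Suc k)"
proof -
  obtain C where C: "C \<ge> 0" and *: "\<And>s y :: real.
      \<bar>(s + y) ^ (2 * k + 2) - s ^ (2 * k + 2) - real (2 * k + 2) * s ^ (2 * k + 1) * y\<bar>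
        \<le> C * y\<^sup>2 * (\<bar>s\<bar> + \<bar>y\<bar>) ^ (2 * k)"
    using power_add_second_order[of "2 * k"] by blast
  have "(s + y) ^ (2 * Suc k)
      \<le> s ^ (2 * Suc k) + real (2 * Suc k) * (s ^ (2 * k + 1) * y)
         + (C * 2 ^ (2 * k)) * (s ^ (2 * k) * y\<^sup>2) + (C * 2 ^ (2 * k)) * y ^ (2 * Suc k)"
    for s y :: real
  proof -
    \<comment> \<open>A sum is at most twice the maximum, and an even power of the maximum is at
      most the sum of the two even powers.\<close>
    have "(\<bar>s\<bar> + \<bar>y\<bar>) ^ (2 * k) \<le> (2 * max \<bar>s\<bar> \<bar>y\<bar>) ^ (2 * k)"
      by (intro power_mono) auto
    also have "\<dots> \<le> 2 ^ (2 * k) * (s ^ (2 * k) + y ^ (2 * k))"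
      by (auto simp: power_mult_distrib max_def power_even_abs)
    finally have "C * y\<^sup>2 * (\<bar>s\<bar> + \<bar>y\<bar>) ^ (2 * k)
        \<le> C * y\<^sup>2 * (2 ^ (2 * k) * (s ^ (2 * k) + y ^ (2 * k)))"
      using C by (intro mult_left_mono) auto
    also have "\<dots> = (C * 2 ^ (2 * k)) * (s ^ (2 * k) * y\<^sup>2) + (C * 2 ^ (2 * k)) * y ^ (2 * Suc k)"
      by (simp add: algebra_simps power2_eq_square)
    finally show ?thesis using *[of s y] by (simp add: mult_ac)
  qed
  with C show thesis by (intro that[of "C * 2 ^ (2 * k)"]) auto
qed

section \<open>Products of independent random variables\<close>

lemma upper_expectation_mono:
  "(\<And>\<omega>. f \<omega> \<le> g \<omega>) \<Longrightarrow> upper_expectation \<P> f \<le> upper_expectation \<P> g"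
  unfolding upper_expectation_def by (intro SUP_mono' nn_integral_mono)

context sublinear_expectation_space
begin

section \<open>Elementary properties of \<open>E\<close>, its representing measures, and closure
  properties of \<open>H\<close>\<close>

lemma expectation_nonneg:
  assumes "X \<in> H" "\<And>\<omega>. X \<omega> \<ge> 0"
  shows "E X \<ge> 0"
  using mono[OF assms(1) const[of 0]] assms(2) const_preserving[of 0] by simp

lemma integral_le_expectation: "P \<in> \<P> \<Longrightarrow> X \<in> H \<Longrightarrow> integral\<^sup>L P X \<le> E X"
  by (simp only: representation) (rule cSUP_upper[OF _ bdd])

text \<open>Used to verify the finiteness conditions in \<open>indep_to\<close>: real values of
  \<open>E\<close> bound the extended expectations that appear there.\<close>

lemma upper_expectation_le_expectation:
  assumes "X \<in> H" "\<And>\<omega>. X \<omega> \<ge> 0"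
  shows "upper_expectation \<P> (\<lambda>\<omega>. ennreal (X \<omega>)) \<le> ennreal (E X)"
  unfolding upper_expectation_def
proof (rule SUP_least)
  fix P assume P: "P \<in> \<P>"
  then have "(\<integral>\<^sup>+\<omega>. ennreal (X \<omega>) \<partial>P) = ennreal (integral\<^sup>L P X)"
    using assms by (intro nn_integral_eq_integral integrable) auto
  also have "\<dots> \<le> ennreal (E X)"
    using P assms(1) by (intro ennreal_leI integral_le_expectation)
  finally show "(\<integral>\<^sup>+\<omega>. ennreal (X \<omega>) \<partial>P) \<le> ennreal (E X)" .
qed

lemma comp_real: "g \<in> C_llip_real \<Longrightarrow> Y \<in> H \<Longrightarrow> (\<lambda>\<omega>. g (Y \<omega>)) \<in> H"
  using comp[of "\<lambda>x. g (x 0)" 1 "\<lambda>_. Y"] by (simp add: C_llip_real_iff)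

lemma power_in_H: "X \<in> H \<Longrightarrow> (\<lambda>\<omega>. X \<omega> ^ k) \<in> H"
  using comp_real[OF C_llip_real_shifted_power[of 0 k]] by simp

lemma mult_in_H:
  assumes "X \<in> H" "Y \<in> H"
  shows "(\<lambda>\<omega>. X \<omega> * Y \<omega>) \<in> H"
  using comp[of "\<lambda>x. x 0 * x 1" 2 "\<lambda>i. if i = 0 then X else Y"] assms
  by (simp add: C_llip_mult C_llip_coord)

text \<open>For a test function in product form both integrability conditions of independence hold
  automatically, since \<open>g (Y \<omega>)\<close> and \<open>f (Z \<omega>)\<close> have absolute
  values in \<open>H\<close>. The nested form is kept because a factor
  \<open>f (Z \<omega>')\<close> of unknown sign cannot be pulled out of \<open>E\<close>.\<close>

lemma expectation_indep_mult:
  assumes indep: "indep_to E \<P> 1 (\<lambda>\<omega> _. Y \<omega>) m Z"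
    and Y: "Y \<in> H" and Z: "\<And>i. i < m \<Longrightarrow> (\<lambda>\<omega>. Z \<omega> i) \<in> H"
    and f: "f \<in> C_llip m" and g: "g \<in> C_llip_real"
  shows "E (\<lambda>\<omega>. f (Z \<omega>) * g (Y \<omega>)) = E (\<lambda>\<omega>'. E (\<lambda>\<omega>. f (Z \<omega>') * g (Y \<omega>)))"
proof -
  \<comment> \<open>Coordinate \<open>m\<close> is the slot that \<open>vec_append\<close> gives to
    \<open>Y\<close>.\<close>
  define \<phi> where "\<phi> = (\<lambda>x. f x * g (x m))"
  have "\<phi> \<in> C_llip (m + 1)"
    unfolding \<phi>_def using f g by (intro C_llip_mult C_llip_real_comp_coord) (auto intro: C_llip_mono_dim)
  have \<phi>_eq: "\<phi> (vec_append m x (\<lambda>_. y)) = f x * g y" for x y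
  proof -
    have "f (vec_append m x (\<lambda>_. y)) = f x"
      by (rule C_llip_cong[OF f]) (simp add: vec_append_def)
    then show ?thesis by (simp add: \<phi>_def vec_append_def)
  qed
  define c where "c = upper_expectation \<P> (\<lambda>\<omega>. ennreal \<bar>g (Y \<omega>)\<bar>)"
  have gY: "(\<lambda>\<omega>. \<bar>g (Y \<omega>)\<bar>) \<in> H" and fZ: "(\<lambda>\<omega>. \<bar>f (Z \<omega>)\<bar>) \<in> H"
    using comp[OF f, of "\<lambda>i \<omega>. Z \<omega> i"] Z comp_real[OF g Y] by (auto intro: abs)
  define d where "d = E (\<lambda>\<omega>. \<bar>g (Y \<omega>)\<bar>)"
  have d: "d \<ge> 0" unfolding d_def by (rule expectation_nonneg[OF gY]) simp
  have bar: "upper_expectation \<P> (\<lambda>\<omega>. ennreal \<bar>f x * g (Y \<omega>)\<bar>) \<le> ennreal (\<bar>f x\<bar> * d)" for x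
  proof -
    have "(\<lambda>\<omega>. \<bar>f x * g (Y \<omega>)\<bar>) \<in> H"
      using scale[OF gY] by (simp add: abs_mult)
    then have "upper_expectation \<P> (\<lambda>\<omega>. ennreal \<bar>f x * g (Y \<omega>)\<bar>)
        \<le> ennreal (E (\<lambda>\<omega>. \<bar>f x * g (Y \<omega>)\<bar>))"
      by (rule upper_expectation_le_expectation) simp
    also have "E (\<lambda>\<omega>. \<bar>f x * g (Y \<omega>)\<bar>) = \<bar>f x\<bar> * d"
      unfolding d_def abs_mult by (rule pos_homogeneous[OF gY]) simp
    finally show ?thesis .
  qed
  have "upper_expectation \<P> (\<lambda>\<omega>'. upper_expectation \<P> (\<lambda>\<omega>. ennreal \<bar>f (Z \<omega>') * g (Y \<omega>)\<bar>))
      \<le> upper_expectation \<P> (\<lambda>\<omega>'. ennreal (d * \<bar>f (Z \<omega>')\<bar>))"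
    using bar by (intro upper_expectation_mono) (simp add: mult.commute)
  also have "\<dots> \<le> ennreal (E (\<lambda>\<omega>. d * \<bar>f (Z \<omega>)\<bar>))"
    using d by (intro upper_expectation_le_expectation scale fZ) auto
  also have "\<dots> < \<infinity>" by simp
  finally have outer: "upper_expectation \<P>
      (\<lambda>\<omega>'. upper_expectation \<P> (\<lambda>\<omega>. ennreal \<bar>f (Z \<omega>') * g (Y \<omega>)\<bar>)) < \<infinity>" .
  have inner: "upper_expectation \<P> (\<lambda>\<omega>. ennreal \<bar>f x * g (Y \<omega>)\<bar>) < \<infinity>" for x
    using bar[of x] by (rule order_le_less_trans) simp
  from indep \<open>\<phi> \<in> C_llip (m + 1)\<close> inner outer show ?thesis
    unfolding indep_to_def Let_def by (auto simp: \<phi>_eq dest!: bspec)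
qed

text \<open>Positive homogeneity is applied twice: \<open>f \<ge> 0\<close> frees the inner factor,
  and \<open>g \<ge> 0\<close> makes the constant
  \<open>E (\<lambda>\<omega>. g (Y \<omega>))\<close> nonnegative, so that it leaves the outer
  expectation.\<close>

lemma expectation_indep_mult_nonneg:
  assumes "indep_to E \<P> 1 (\<lambda>\<omega> _. Y \<omega>) m Z"
    and "Y \<in> H" and Z: "\<And>i. i < m \<Longrightarrow> (\<lambda>\<omega>. Z \<omega> i) \<in> H"
    and f: "f \<in> C_llip m" "\<And>x. f x \<ge> 0" and g: "g \<in> C_llip_real" "\<And>y. g y \<ge> 0"
  shows "E (\<lambda>\<omega>. f (Z \<omega>) * g (Y \<omega>)) = E (\<lambda>\<omega>. f (Z \<omega>)) * E (\<lambda>\<omega>. g (Y \<omega>))"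
proof -
  have gY: "(\<lambda>\<omega>. g (Y \<omega>)) \<in> H" and fZ: "(\<lambda>\<omega>. f (Z \<omega>)) \<in> H"
    using assms comp[OF f(1), of "\<lambda>i \<omega>. Z \<omega> i"] by (auto intro: comp_real)
  have "E (\<lambda>\<omega>. f (Z \<omega>) * g (Y \<omega>)) = E (\<lambda>\<omega>'. E (\<lambda>\<omega>. g (Y \<omega>)) * f (Z \<omega>'))"
    using expectation_indep_mult[OF assms(1-3) f(1) g(1)] pos_homogeneous[OF gY f(2)]
    by (simp add: mult.commute)
  also have "\<dots> = E (\<lambda>\<omega>. g (Y \<omega>)) * E (\<lambda>\<omega>. f (Z \<omega>))"
    using g by (intro pos_homogeneous fZ expectation_nonneg gY)
  finally show ?thesis by (simp add: mult.commute)
qed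

text \<open>Homogeneity of \<open>E\<close> covers only nonnegative factors; a negative
  \<open>c\<close> is handled by applying it to \<open>- Y\<close>, whose expectation also
  vanishes.\<close>

lemma expectation_scale_certain_mean_zero:
  assumes "Y \<in> H" "E Y = 0" "E (\<lambda>\<omega>. - Y \<omega>) = 0"
  shows "E (\<lambda>\<omega>. c * Y \<omega>) = 0"
proof (cases "c \<ge> 0")
  case True
  then show ?thesis using pos_homogeneous assms by simp
next
  case False
  then have "E (\<lambda>\<omega>. (- c) * (- Y \<omega>)) = 0"
    using pos_homogeneous[of "\<lambda>\<omega>. - Y \<omega>" "- c"] scale[OF assms(1), of "-1"] assms by simp
  then show ?thesis by simp
qed

text \<open>Subadditivity gives one inequality; applied after adding \<open>- c\<close> back it
  gives the other.\<close>

lemma expectation_add_const: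
  assumes "X \<in> H"
  shows "E (\<lambda>\<omega>. X \<omega> + c) = E X + c"
proof (rule antisym)
  show "E (\<lambda>\<omega>. X \<omega> + c) \<le> E X + c"
    using subadditive[OF assms const[of c]] const_preserving by simp
  show "E X + c \<le> E (\<lambda>\<omega>. X \<omega> + c)"
    using subadditive[OF add[OF assms const[of c]] const[of "- c"]] const_preserving[of "- c"]
    by simp
qed

section \<open>Moments of centred sums\<close>

lemma centred_sum_in_H:
  assumes "\<And>i. i \<ge> 1 \<Longrightarrow> X i \<in> H"
  shows "(\<lambda>\<omega>. \<Sum>i<n. X (Suc i) \<omega> - \<mu>) \<in> H"
proof (induction n)
  case 0
  show ?case using const[of 0] by simp
next
  case (Suc n)
  have "(\<lambda>\<omega>. X (Suc n) \<omega> + - \<mu>) \<in> H" by (intro add const assms) simp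
  then show ?case using add[OF Suc] by simp
qed

text \<open>This is \<open>even_power_add_le\<close> with \<open>s\<close> the current sum and
  \<open>y\<close> the next centred variable, under \<open>E\<close>. Identical distribution makes
  the moments of \<open>y\<close>, and hence \<open>D\<close>, independent of
  \<open>n\<close>.\<close>

lemma centred_sum_moment_step:
  assumes iid: "iid_seq H E \<P> X"
    and mean: "\<And>n. n \<ge> 1 \<Longrightarrow> E (X n) = \<mu>" "\<And>n. n \<ge> 1 \<Longrightarrow> - E (\<lambda>\<omega>. - X n \<omega>) = \<mu>"
  obtains D where "D \<ge> 0"
    "\<And>n. E (\<lambda>\<omega>. (\<Sum>i<Suc n. X (Suc i) \<omega> - \<mu>) ^ (2 * Suc k))
      \<le> E (\<lambda>\<omega>. (\<Sum>i<n. X (Suc i) \<omega> - \<mu>) ^ (2 * Suc k))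
        + D * E (\<lambda>\<omega>. (\<Sum>i<n. X (Suc i) \<omega> - \<mu>) ^ (2 * k)) + D"
proof -
  have XH: "X i \<in> H" if "i \<ge> 1" for i using iid that by (auto simp: iid_seq_def)
  define S where "S n = (\<lambda>\<omega>. \<Sum>i<n. X (Suc i) \<omega> - \<mu>)" for n
  have SH: "S n \<in> H" for n unfolding S_def by (intro centred_sum_in_H XH)
  define M where "M j = E (\<lambda>\<omega>. (X 1 \<omega> - \<mu>) ^ j)" for j
  have M: "E (\<lambda>\<omega>. (X (Suc n) \<omega> - \<mu>) ^ j) = M j" for n j
    using iid C_llip_real_shifted_power[of \<mu> j] unfolding iid_seq_def ident_distr_def M_def by auto
  have M0: "M (2 * j) \<ge> 0" for j
    unfolding M_def
    by (intro expectation_nonneg comp_real[OF C_llip_real_shifted_power] XH)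
      (auto simp: zero_le_even_power)
  obtain C where C: "C \<ge> 0" and expand: "\<And>s y :: real. (s + y) ^ (2 * Suc k)
      \<le> s ^ (2 * Suc k) + real (2 * Suc k) * (s ^ (2 * k + 1) * y)
         + C * (s ^ (2 * k) * y\<^sup>2) + C * y ^ (2 * Suc k)"
    using even_power_add_le[of k] by blast
  \<comment> \<open>\<open>D\<close> dominates the coefficient of the lower moment, the additive
    term, and the first moment bound needed for \<open>n = 0\<close>.\<close>
  define D where "D = C * M 2 + (C + 1) * M (2 * Suc k)"
  have D: "D \<ge> C * M 2" "D \<ge> C * M (2 * Suc k)" "D \<ge> M (2 * Suc k)" "D \<ge> 0"
    using mult_nonneg_nonneg[OF C M0[of 1]] mult_nonneg_nonneg[OF C M0[of "Suc k"]]
      M0[of "Suc k"]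
    unfolding D_def distrib_right mult_1 mult_1_right by linarith+
  have S0: "E (\<lambda>\<omega>. S n \<omega> ^ (2 * j)) \<ge> 0" for n j
    by (intro expectation_nonneg power_in_H SH) (simp add: zero_le_even_power)
  have "E (\<lambda>\<omega>. S (Suc n) \<omega> ^ (2 * Suc k))
      \<le> E (\<lambda>\<omega>. S n \<omega> ^ (2 * Suc k)) + D * E (\<lambda>\<omega>. S n \<omega> ^ (2 * k)) + D" for n
  \<comment> \<open>\<open>iid_seq\<close> provides independence only from a nonempty past, so the
    first summand is treated directly.\<close>
  proof (cases "n = 0")
    case True
    have "E (\<lambda>\<omega>. S (Suc n) \<omega> ^ (2 * Suc k)) = M (2 * Suc k)"
      using True by (simp add: S_def M_def del: power_Suc mult_Suc_right)
    with D(3) S0[of n "Suc k"] mult_nonneg_nonneg[OF D(4) S0[of n k]] show ?thesis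
      by linarith
  next
    case False
    define Y where "Y = (\<lambda>\<omega>. X (Suc n) \<omega> - \<mu>)"
    have YH: "Y \<in> H" unfolding Y_def using add[OF XH const[of "- \<mu>"], of "Suc n"] by simp
    have EY: "E Y = 0" "E (\<lambda>\<omega>. - Y \<omega>) = 0"
      using expectation_add_const[OF XH, of "Suc n" "- \<mu>"] mean[of "Suc n"]
        expectation_add_const[OF scale[OF XH, of "Suc n" "-1"], of \<mu>]
      by (simp_all add: Y_def)
    have indep: "indep_to E \<P> 1 (\<lambda>\<omega> _. X (Suc n) \<omega>) n (\<lambda>\<omega> j. X (Suc j) \<omega>)"
      using iid False unfolding iid_seq_def by simp
    have f: "(\<lambda>x. (\<Sum>i<n. x i - \<mu>) ^ j) \<in> C_llip n" for j
    proof -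
      have "(\<lambda>x. (\<Sum>i<n. x i + - \<mu>) ^ j) \<in> C_llip n"
        by (intro C_llip_power C_llip_sum C_llip_add C_llip_coord C_llip_const) simp
      then show ?thesis by simp
    qed
    \<comment> \<open>The odd power of \<open>S n\<close> may have either sign; the linear term
      vanishes because both \<open>Y\<close> and \<open>- Y\<close> have expectation 0.\<close>
    have lin: "E (\<lambda>\<omega>. S n \<omega> ^ (2 * k + 1) * Y \<omega>) = 0"
    proof -
      have "E (\<lambda>\<omega>. S n \<omega> ^ (2 * k + 1) * Y \<omega>)
          = E (\<lambda>\<omega>'. E (\<lambda>\<omega>. S n \<omega>' ^ (2 * k + 1) * Y \<omega>))"
        using expectation_indep_mult[OF indep _ _ f[of "2 * k + 1"]
            C_llip_real_shifted_power[of \<mu> 1]]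
        by (simp add: XH S_def Y_def)
      also have "\<dots> = E (\<lambda>_. 0)"
        by (simp only: expectation_scale_certain_mean_zero[OF YH EY])
      finally show ?thesis by (simp add: const_preserving)
    qed
    have quad: "E (\<lambda>\<omega>. S n \<omega> ^ (2 * k) * (Y \<omega>)\<^sup>2) = E (\<lambda>\<omega>. S n \<omega> ^ (2 * k)) * M 2"
      using expectation_indep_mult_nonneg[OF indep _ _ f[of "2 * k"] _
          C_llip_real_shifted_power[of \<mu> 2]] M[of n 2]
      by (simp add: XH S_def Y_def)
    let ?A = "\<lambda>\<omega>. S n \<omega> ^ (2 * Suc k)"
      and ?B = "\<lambda>\<omega>. real (2 * Suc k) * (S n \<omega> ^ (2 * k + 1) * Y \<omega>)"
      and ?C = "\<lambda>\<omega>. C * (S n \<omega> ^ (2 * k) * (Y \<omega>)\<^sup>2)" and ?D = "\<lambda>\<omega>. C * Y \<omega> ^ (2 * Suc k)"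
    have AH: "?A \<in> H" "?B \<in> H" "?C \<in> H" "?D \<in> H"
      by (intro scale mult_in_H power_in_H SH YH)+
    have "S (Suc n) \<omega> = S n \<omega> + Y \<omega>" for \<omega> by (simp add: S_def Y_def)
    then have "E (\<lambda>\<omega>. S (Suc n) \<omega> ^ (2 * Suc k)) \<le> E (\<lambda>\<omega>. ?A \<omega> + ?B \<omega> + ?C \<omega> + ?D \<omega>)"
      using expand by (intro mono add AH power_in_H SH) (simp del: power_Suc mult_Suc_right)
    also have "\<dots> \<le> E (\<lambda>\<omega>. ?A \<omega> + ?B \<omega> + ?C \<omega>) + E ?D"
      by (intro subadditive add AH)
    also have "E (\<lambda>\<omega>. ?A \<omega> + ?B \<omega> + ?C \<omega>) \<le> E (\<lambda>\<omega>. ?A \<omega> + ?B \<omega>) + E ?C"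
      by (intro subadditive add AH)
    also have "E (\<lambda>\<omega>. ?A \<omega> + ?B \<omega>) \<le> E ?A + E ?B"
      by (intro subadditive AH)
    also have "E ?B = 0"
      using pos_homogeneous[of "\<lambda>\<omega>. S n \<omega> ^ (2 * k + 1) * Y \<omega>" "real (2 * Suc k)"] lin
      by (simp add: mult_in_H power_in_H SH YH del: power_Suc)
    also have "E ?C = C * (E (\<lambda>\<omega>. S n \<omega> ^ (2 * k)) * M 2)"
      using pos_homogeneous[OF _ C, of "\<lambda>\<omega>. S n \<omega> ^ (2 * k) * (Y \<omega>)\<^sup>2"] quad
      by (simp add: mult_in_H power_in_H SH YH)
    also have "E ?D = C * M (2 * Suc k)"
      using pos_homogeneous[OF power_in_H[OF YH] C, of "2 * Suc k"] M[of n "2 * Suc k"]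
      by (simp add: Y_def del: power_Suc)
    also have "C * (E (\<lambda>\<omega>. S n \<omega> ^ (2 * k)) * M 2) \<le> D * E (\<lambda>\<omega>. S n \<omega> ^ (2 * k))"
      using mult_right_mono[OF D(1) S0[of n k]] by (simp add: mult_ac)
    finally show ?thesis using D(2) by simp
  qed
  with D(4) show thesis using that unfolding S_def by blast
qed

lemma centred_sum_moment_bound:
  assumes iid: "iid_seq H E \<P> X"
    and mean: "\<And>n. n \<ge> 1 \<Longrightarrow> E (X n) = \<mu>" "\<And>n. n \<ge> 1 \<Longrightarrow> - E (\<lambda>\<omega>. - X n \<omega>) = \<mu>"
  shows "\<exists>B\<ge>0. \<forall>n. E (\<lambda>\<omega>. (\<Sum>i<n. X (Suc i) \<omega> - \<mu>) ^ (2 * k)) \<le> B * real n ^ k"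
proof (induction k)
  case 0
  show ?case by (rule exI[of _ 1]) (simp add: const_preserving)
next
  case (Suc k)
  define a where "a k n = E (\<lambda>\<omega>. (\<Sum>i<n. X (Suc i) \<omega> - \<mu>) ^ (2 * k))" for k n
  from Suc obtain B where B: "B \<ge> 0" "\<And>n. a k n \<le> B * real n ^ k"
    unfolding a_def by blast
  obtain D where D: "D \<ge> 0" "\<And>n. a (Suc k) (Suc n) \<le> a (Suc k) n + D * a k n + D"
    using centred_sum_moment_step[OF iid mean] unfolding a_def by metis
  \<comment> \<open>Each step adds at most \<open>D * (B + 1) * real (Suc n) ^ k\<close>, and
    \<open>n + 1\<close> such increments give the next power of \<open>Suc n\<close>. The induction
    starts from the empty sum, where both sides are 0.\<close>
  have "a (Suc k) n \<le> D * (B + 1) * real n ^ Suc k" for n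
  proof (induction n)
    case 0
    show ?case by (simp add: a_def const_preserving)
  next
    case (Suc n)
    have "D * a k n \<le> D * (B * real (Suc n) ^ k)"
      using B D(1) by (intro mult_left_mono order_trans[OF B(2)] power_mono) auto
    moreover have "D * 1 \<le> D * real (Suc n) ^ k"
      using D(1) by (intro mult_left_mono one_le_power) auto
    moreover have "D * (B + 1) * real n ^ Suc k \<le> D * (B + 1) * (real n * real (Suc n) ^ k)"
      using B D(1) by (auto intro!: mult_left_mono power_mono)
    ultimately have "a (Suc k) (Suc n)
        \<le> D * (B + 1) * (real n * real (Suc n) ^ k) + D * (B * real (Suc n) ^ k)
           + D * real (Suc n) ^ k"
      using D(2)[of n] Suc by linarith
    also have "\<dots> = D * (B + 1) * real (Suc n) ^ Suc k"
      by (simp add: algebra_simps)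
    finally show ?case .
  qed
  with B D show ?case unfolding a_def by (intro exI[of _ "D * (B + 1)"]) auto
qed

section \<open>Quasi-sure summability\<close>

text \<open>The capacity of \<open>N\<close> is the supremum of its probabilities. The exceptional
  set must be one and the same for all measures in \<open>\<P>\<close>.\<close>

lemma quasi_surelyI_AE:
  assumes N: "N \<in> sets borel" and "\<And>P. P \<in> \<P> \<Longrightarrow> AE \<omega> in P. \<omega> \<notin> N"
    and "\<And>\<omega>. \<omega> \<notin> N \<Longrightarrow> Q \<omega>"
  shows "quasi_surely E Q"
proof -
  have "integral\<^sup>L P (indicat_real N) = 0" if P: "P \<in> \<P>" for P
  proof -
    have "AE \<omega> in P. indicat_real N \<omega> = 0"
      using assms(2)[OF P] by (auto simp: indicator_def)
    then show ?thesis by (rule integral_eq_zero_AE)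
  qed
  then have "capacity E N = (SUP P\<in>\<P>. 0)"
    unfolding capacity_def representation[OF indicat[OF N]] by (intro SUP_cong) auto
  \<comment> \<open>A real supremum over an empty index set would have no useful value, so
    \<open>\<P>\<close> must be nonempty here.\<close>
  then have "capacity E N = 0" using nonempty by simp
  with assms show ?thesis unfolding quasi_surely_def by blast
qed

text \<open>Under each measure the series has finite integral, by monotone convergence and the
  bounds \<open>c n\<close>, hence is finite almost everywhere.\<close>

lemma quasi_surely_summable:
  fixes a :: "nat \<Rightarrow> 'a \<Rightarrow> real"
  assumes meas: "\<And>n. a n \<in> borel_measurable borel" and nonneg: "\<And>n \<omega>. a n \<omega> \<ge> 0"
    and le: "\<And>P n. P \<in> \<P> \<Longrightarrow> (\<integral>\<^sup>+\<omega>. ennreal (a n \<omega>) \<partial>P) \<le> ennreal (c n)"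
    and c: "summable c" "\<And>n. c n \<ge> 0"
  shows "quasi_surely E (\<lambda>\<omega>. summable (\<lambda>n. a n \<omega>))"
proof (rule quasi_surelyI_AE)
  note [measurable] = meas
  \<comment> \<open>The divergence set is defined pathwise and so does not depend on the
    measure.\<close>
  let ?N = "{\<omega>. (\<Sum>n. ennreal (a n \<omega>)) = \<infinity>}"
  show "?N \<in> sets borel" by measurable
  fix P assume P: "P \<in> \<P>"
  have meas_P [measurable]: "a n \<in> borel_measurable P" for n
    using meas measurable_cong_sets[OF sets_eq[OF P] refl] by blast
  have "(\<integral>\<^sup>+\<omega>. (\<Sum>n. ennreal (a n \<omega>)) \<partial>P) = (\<Sum>n. \<integral>\<^sup>+\<omega>. ennreal (a n \<omega>) \<partial>P)"
    by (intro nn_integral_suminf) measurable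
  also have "\<dots> \<le> (\<Sum>n. ennreal (c n))"
    using le[OF P] by (intro suminf_le) auto
  also have "\<dots> = ennreal (\<Sum>n. c n)"
    using c by (intro suminf_ennreal2) auto
  finally have "(\<integral>\<^sup>+\<omega>. (\<Sum>n. ennreal (a n \<omega>)) \<partial>P) \<noteq> \<infinity>"
    by (auto simp: top_unique)
  then have "AE \<omega> in P. (\<Sum>n. ennreal (a n \<omega>)) \<noteq> \<infinity>"
    by (intro nn_integral_noteq_infinite) measurable
  then show "AE \<omega> in P. \<omega> \<notin> ?N" by simp
next
  fix \<omega> assume "\<omega> \<notin> {\<omega>. (\<Sum>n. ennreal (a n \<omega>)) = \<infinity>}"
  then show "summable (\<lambda>n. a n \<omega>)"
    using nonneg by (intro summable_suminf_not_top) auto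
qed

text \<open>With \<open>u\<close> the size of \<open>t\<close> relative to \<open>sqrt x\<close>,
  the decay rate separates from \<open>u powr \<beta>\<close>, which is at most 1 for
  \<open>u \<le> 1\<close> and at most \<open>u ^ (2 * k)\<close> otherwise.\<close>

lemma powr_div_le:
  fixes t x \<beta> :: real
  assumes x: "x > 0" and \<beta>: "0 \<le> \<beta>" "\<beta> \<le> real (2 * k)"
  shows "\<bar>t / x\<bar> powr \<beta> \<le> x powr (- (\<beta> / 2)) * (1 + t ^ (2 * k) / x ^ k)"
proof -
  define u where "u = \<bar>t\<bar> / sqrt x"
  have u0: "u \<ge> 0" using x by (simp add: u_def)
  have "\<bar>t / x\<bar> = x powr (- (1 / 2)) * u"
    using x by (simp add: u_def powr_minus powr_half_sqrt abs_divide field_simps)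
  then have "\<bar>t / x\<bar> powr \<beta> = x powr (- (\<beta> / 2)) * u powr \<beta>"
    by (simp add: powr_mult powr_powr)
  also have "u powr \<beta> \<le> 1 + u ^ (2 * k)"
  proof (cases "u \<le> 1")
    case True
    then have "u powr \<beta> \<le> 1" using u0 \<beta> by (intro powr_le1) auto
    then show ?thesis using zero_le_power[OF u0, of "2 * k"] by linarith
  next
    case False
    then have "u powr \<beta> \<le> u powr real (2 * k)" using \<beta> by (intro powr_mono) auto
    also have "\<dots> = u ^ (2 * k)" using False by (intro powr_realpow) auto
    finally show ?thesis by simp
  qed
  also have "u ^ (2 * k) = t ^ (2 * k) / x ^ k"
    using x by (simp add: u_def power_divide power_mult)
  finally show ?thesis by (simp add: mult_left_mono)
qed

lemma centred_mean_summable: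
  assumes iid: "iid_seq H E \<P> X"
    and mean: "\<And>n. n \<ge> 1 \<Longrightarrow> E (X n) = \<mu>" "\<And>n. n \<ge> 1 \<Longrightarrow> - E (\<lambda>\<omega>. - X n \<omega>) = \<mu>"
    and \<beta>: "\<beta> > 2"
  shows "quasi_surely E
    (\<lambda>\<omega>. summable (\<lambda>n. \<bar>(\<Sum>i<Suc n. X (Suc i) \<omega> - \<mu>) / real (Suc n)\<bar> powr \<beta>))"
proof -
  define S where "S n = (\<lambda>\<omega>. \<Sum>i<n. X (Suc i) \<omega> - \<mu>)" for n
  have SH: "S n \<in> H" for n
    using iid unfolding S_def iid_seq_def by (intro centred_sum_in_H) auto
  define k where "k = nat \<lceil>\<beta>\<rceil>"
  have k: "\<beta> \<le> real (2 * k)" using \<beta> unfolding k_def by linarith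
  obtain B where B: "B \<ge> 0" "\<And>n. E (\<lambda>\<omega>. S n \<omega> ^ (2 * k)) \<le> B * real n ^ k"
    using centred_sum_moment_bound[OF iid mean] unfolding S_def by blast
  have "quasi_surely E (\<lambda>\<omega>. summable (\<lambda>n. \<bar>S (Suc n) \<omega> / real (Suc n)\<bar> powr \<beta>))"
  proof (rule quasi_surely_summable[where c = "\<lambda>n. (1 + B) * real (Suc n) powr (- (\<beta> / 2))"])
    show "(\<lambda>\<omega>. \<bar>S (Suc n) \<omega> / real (Suc n)\<bar> powr \<beta>) \<in> borel_measurable borel" for n
      using borel[OF SH, of "Suc n"] by measurable
    \<comment> \<open>The assumption \<open>\<beta> > 2\<close> enters here: it makes the exponent
      smaller than -1.\<close>
    have "summable (\<lambda>n. real n powr (- (\<beta> / 2)))"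
      using \<beta> by (simp add: summable_real_powr_iff)
    then have "summable (\<lambda>n. real (Suc n) powr (- (\<beta> / 2)))"
      by (subst summable_Suc_iff)
    then show "summable (\<lambda>n. (1 + B) * real (Suc n) powr (- (\<beta> / 2)))"
      by (rule summable_mult)
    fix P n assume P: "P \<in> \<P>"
    interpret prob_space P by (rule prob[OF P])
    let ?x = "real (Suc n)"
    let ?f = "\<lambda>\<omega>. ?x powr (- (\<beta> / 2)) * (1 + S (Suc n) \<omega> ^ (2 * k) / ?x ^ k)"
    have int: "integrable P (\<lambda>\<omega>. S (Suc n) \<omega> ^ (2 * k))"
      by (intro integrable[OF P] power_in_H SH)
    have "(\<integral>\<^sup>+\<omega>. ennreal (\<bar>S (Suc n) \<omega> / ?x\<bar> powr \<beta>) \<partial>P) \<le> (\<integral>\<^sup>+\<omega>. ennreal (?f \<omega>) \<partial>P)"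
      using \<beta> k by (intro nn_integral_mono ennreal_leI powr_div_le) auto
    also have "\<dots> = ennreal (\<integral>\<omega>. ?f \<omega> \<partial>P)"
      using int by (intro nn_integral_eq_integral) (auto simp: zero_le_even_power)
    also have "(\<integral>\<omega>. ?f \<omega> \<partial>P)
        = ?x powr (- (\<beta> / 2)) * (1 + (\<integral>\<omega>. S (Suc n) \<omega> ^ (2 * k) \<partial>P) / ?x ^ k)"
      using int by (simp add: prob_space del: of_nat_Suc)
    also have "\<dots> \<le> ?x powr (- (\<beta> / 2)) * (1 + B)"
    proof -
      \<comment> \<open>The moment growth of order \<open>k\<close> in \<open>?x\<close> cancels
        against the normalisation, leaving a bound uniform in \<open>n\<close> and
        \<open>P\<close>.\<close>
      have "(\<integral>\<omega>. S (Suc n) \<omega> ^ (2 * k) \<partial>P) \<le> B * ?x ^ k"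
        by (rule order_trans[OF integral_le_expectation[OF P power_in_H[OF SH]] B(2)])
      then have "(\<integral>\<omega>. S (Suc n) \<omega> ^ (2 * k) \<partial>P) / ?x ^ k \<le> B"
        by (simp add: divide_le_eq del: of_nat_Suc)
      then show ?thesis by (intro mult_left_mono) auto
    qed
    finally show "(\<integral>\<^sup>+\<omega>. ennreal (\<bar>S (Suc n) \<omega> / ?x\<bar> powr \<beta>) \<partial>P)
        \<le> ennreal ((1 + B) * ?x powr (- (\<beta> / 2)))"
      by (simp add: mult.commute ennreal_leI)
  qed (use B in auto)
  then show ?thesis by (simp only: S_def)
qed

end

theorem proposition3p5:
  fixes H :: "('a::polish_space \<Rightarrow> real) set"
    and E :: "('a \<Rightarrow> real) \<Rightarrow> real"
    and \<P> :: "'a measure set"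
    and X :: "nat \<Rightarrow> 'a \<Rightarrow> real"
    and \<mu> \<alpha> \<beta> :: real
  assumes "sublinear_expectation_space H E \<P>"
    and "iid_seq H E \<P> X"
    and "\<And>n. n \<ge> 1 \<Longrightarrow> E (X n) = \<mu>"
    and "\<And>n. n \<ge> 1 \<Longrightarrow> - E (\<lambda>\<omega>. - X n \<omega>) = \<mu>"
    and "\<alpha> > 2"
    and "upper_expectation \<P> (\<lambda>\<omega>. ennreal (\<bar>X 1 \<omega>\<bar> powr \<alpha>)) < \<infinity>"
    and "\<beta> > 2"
  shows "strongly_qs_converges E (\<lambda>n \<omega>. (\<Sum>i=1..n. X i \<omega> - E (X i)) / real n) (\<lambda>\<omega>. 0) \<beta>
    \<and> strongly_qs_converges E (\<lambda>n \<omega>. (\<Sum>i=1..n. X i \<omega>) / real n) (\<lambda>\<omega>. \<mu>) \<beta>"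
proof -
  interpret sublinear_expectation_space H E \<P> by fact
  have sum: "(\<Sum>i=1..Suc n. f i) = (\<Sum>i<Suc n. f (Suc i))" for f :: "nat \<Rightarrow> real" and n
    by (rule sum.reindex_bij_witness[of _ Suc "\<lambda>i. i - 1"]) auto
  \<comment> \<open>Both series of the claim have the same terms as the series in
    \<open>centred_mean_summable\<close>, since every \<open>E (X i)\<close> with
    \<open>i \<ge> 1\<close> equals \<open>\<mu>\<close>.\<close>
  have "(\<Sum>i=1..Suc n. X i \<omega> - E (X i)) / real (Suc n) - 0
      = (\<Sum>i<Suc n. X (Suc i) \<omega> - \<mu>) / real (Suc n)" for n \<omega>
    unfolding sum using assms(3) by simp
  moreover have "(\<Sum>i=1..Suc n. X i \<omega>) / real (Suc n) - \<mu>
      = (\<Sum>i<Suc n. X (Suc i) \<omega> - \<mu>) / real (Suc n)" for n \<omega>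
    unfolding sum sum_subtractf by (simp add: field_simps)
  ultimately show ?thesis
    using centred_mean_summable[OF assms(2-4) assms(7)]
    unfolding strongly_qs_converges_def by (simp only: simp_thms)
qed

end
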